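(* Let $C$ be a row-finite $\omega\times\omega$ matrix over a field $\mathcal F$, let $L$ be the matrix resulting from $C$ by the infinite Gauss-Jordan algorithm with rightmost pivots, let $\mathcal Q^{(n)}$ be the result of the reordering routine applied to the top submatrix $L|_n$ ($n\in\omega$), and let $H$ be the quasi-Hermite form of $C$ obtained by applying the reordering routine to $L$. For every $n\in\omega$ there is $\delta_n\in\omega$ with $\delta_n\ge n$ such that $\mathcal Q^{(\delta_n)}|_n\sqsubset H$. Thus a chain of top submatrices of $H$ is generated satisfying $$\mathcal Q^{(\delta_0)}|_0\sqsubset \mathcal Q^{(\delta_1)}|_1\sqsubset\cdots\sqsubset \mathcal Q^{(\delta_n)}|_n\sqsubset\cdots\sqsubset H .$$
   Context: $\omega=\{0,1,2,\dots\}$. $\mathcal F$ is a field and $\mathcal F^{(\omega)}$ is the space of sequences in $\mathcal F$ with finitely many nonzero terms. A row-finite $\omega\times\omega$ matrix is a sequence $C=(C_n)_{n\in\omega}$ of rows $C_n\in\mathcal F^{(\omega)}$. For nonzero $x\in\mathcal F^{(\omega)}$ the length $\ell(x)$ is the largest index $i$ with $x_i\ne0$; $\ell(\mathbf 0)=-1$. For a (finite or infinite) sequence of rows $A$, $A|_n=(A_k)_{0\le k\le n}$ is its top submatrix of order $n$. Sequences of rows are regarded as sets of pairs (row index, row), and $A\sqsubset B$ means that $A$ is a strict submatrix of $B$, i.e. strict inclusion of these sets. Infinite Gauss-Jordan algorithm with rightmost pivots applied to $C$. It produces vectors $L^{(i)}_n\in\mathcal F^{(\omega)}$ (entries $l^{(i)}_{nj}$)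 for $n\in\omega$, $i\ge -1$, and $G_n=L^{(n)}_n$, stage by stage for $n=0,1,2,\dots$. Stage $n$ uses the vectors $L^{(n-1)}_0,\dots,L^{(n-1)}_{n-1}$ of the previous stage: (1) Gaussian elimination: $L^{(-1)}_n=C_n$; for $i=0,1,\dots,n-1$ in this order, $L^{(i)}_n=L^{(i-1)}_n-l^{(i-1)}_{n\rho_i}L^{(n-1)}_i$ with $\rho_i=\ell(L^{(n-1)}_i)$ if $L^{(n-1)}_i\ne\mathbf 0$, and $L^{(i)}_n=L^{(i-1)}_n$ if $L^{(n-1)}_i=\mathbf 0$. (2) Normalization: $L^{(n)}_n=G_n$, where $G_n$ is $L^{(n-1)}_n$ divided by its rightmost nonzero entry if $L^{(n-1)}_n\neq\mathbf 0$, and $G_n=\mathbf 0$ otherwise. (3) Jordan elimination: for $0\le i\le n-1$, $L^{(n)}_i=L^{(n-1)}_i-l^{(n-1)}_{i\rho_n}G_n$ with $\rho_n=\ell(G_n)$ if $G_n\neq\mathbf 0$, and $L^{(n)}_i=L^{(n-1)}_i$ if $G_n=\mathbf 0$. For each $k$ the sequence $(L^{(n)}_k)_{n\ge k}$ is eventually constant, and $L_k$ denotes its eventual value; $L=(L_k)_{k\in\omega}$. Distinct nonzero rows of $L$ have distinct lengths. Reordering routine: $\mathcal Q^{(n)}$ is the finite sequence of $n+1$ rows obtained from $L|_n$ by rearranging its nonzero rows (among the positions occupied by nonzero rows) in strictly increasing row-length, while leaving the positions of the zero rows unchanged. For each $k$ the sequence $(\mathcal Q^{(n)}|_k)_{n\ge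 k}$ is eventually constant; $H=(H_k)_{k\in\omega}$ is the row-finite matrix whose top submatrix $H|_k$ is this eventual value for every $k$. Quasi-Hermite form: a row-finite matrix $H=(h_{ki})$ with set $J$ of indices of nonzero rows and $\rho_j=\ell(H_j)$ is in quasi-Hermite form if $(\rho_j)_{j\in J}$ is strictly increasing, $h_{j\rho_j}=1$ for all $j\in J$, and $h_{k\rho_j}=0$ whenever $j\in J$, $k\in\omega$, $j<k$. It is a quasi-Hermite form of $C$ if moreover $H=Q\cdot C$ for some row-finite $Q$ having a two-sided row-finite inverse. *)

theory Defs
  imports Complex_Main "HOL-Library.Poly_Mapping"
begin

section \<open>Row-finite matrices\<close>

type_synonym 'a row = "nat \<Rightarrow>\<^sub>0 'a"
type_synonym 'a rf_matrix = "nat \<Rightarrow> 'a row"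

definition row_length :: "'a::zero row \<Rightarrow> int" where
  "row_length x = (if x = 0 then -1 else int (Max (Poly_Mapping.keys x)))"

text \<open>Column index of the rightmost nonzero entry; only meaningful for nonzero rows.\<close>

definition pivot :: "'a::zero row \<Rightarrow> nat" where
  "pivot x = nat (row_length x)"

definition scale_row :: "'a::field \<Rightarrow> 'a row \<Rightarrow> 'a row" where
  "scale_row c x = Poly_Mapping.map ((*) c) x"

definition rf_mult :: "'a::field rf_matrix \<Rightarrow> 'a rf_matrix \<Rightarrow> 'a rf_matrix" where
  "rf_mult A B = (\<lambda>n. \<Sum>k\<in>Poly_Mapping.keys (A n). scale_row (Poly_Mapping.lookup (A n) k) (B k))"

definition rf_one :: "'a::field rf_matrix" where
  "rf_one = (\<lambda>n. Poly_Mapping.single n 1)"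

definition rf_invertible :: "'a::field rf_matrix \<Rightarrow> bool" where
  "rf_invertible Q \<longleftrightarrow> (\<exists>P. rf_mult Q P = rf_one \<and> rf_mult P Q = rf_one)"

definition quasi_hermite :: "'a::field rf_matrix \<Rightarrow> bool" where
  "quasi_hermite H \<longleftrightarrow>
     (let J = {j. H j \<noteq> 0} in
        strict_mono_on J (\<lambda>j. row_length (H j)) \<and>
        (\<forall>j\<in>J. Poly_Mapping.lookup (H j) (pivot (H j)) = 1) \<and>
        (\<forall>j\<in>J. \<forall>k>j. Poly_Mapping.lookup (H k) (pivot (H j)) = 0))"

definition quasi_hermite_form_of :: "'a::field rf_matrix \<Rightarrow> 'a rf_matrix \<Rightarrow> bool" where
  "quasi_hermite_form_of H C \<longleftrightarrow>
     quasi_hermite H \<and> (\<exists>Q. rf_invertible Q \<and> H = rf_mult Q C)"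


section \<open>Finite and infinite sequences of rows\<close>

text \<open>A sequence of rows is a partial map from row indices to rows, so that its graph is the set
  of pairs (row index, row): an infinite matrix \<open>A\<close> is \<open>Some \<circ> A\<close>, and a finite
  sequence of \<open>n + 1\<close> rows has domain \<open>{..n}\<close>.\<close>

type_synonym 'a row_seq = "nat \<rightharpoonup> 'a row"

definition top_submatrix :: "'a::zero row_seq \<Rightarrow> nat \<Rightarrow> 'a row_seq" where
  "top_submatrix A n = A |` {..n}"

definition strict_submatrix :: "'a::zero row_seq \<Rightarrow> 'a row_seq \<Rightarrow> bool" where
  "strict_submatrix A B \<longleftrightarrow> Map.graph A \<subset> Map.graph B"


section \<open>Infinite Gauss--Jordan algorithm with rightmost pivots\<close>

definition eliminate :: "'a::field row \<Rightarrow> 'a row \<Rightarrow> 'a row" where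
  "eliminate r v = (if r = 0 then v else v - scale_row (Poly_Mapping.lookup v (pivot r)) r)"

definition normalize_row :: "'a::field row \<Rightarrow> 'a row" where
  "normalize_row v = (if v = 0 then 0 else scale_row (inverse (Poly_Mapping.lookup v (pivot v))) v)"

text \<open>Stage \<open>n\<close> acts on the matrix \<open>M\<close> whose rows \<open>0, \<dots>, n - 1\<close> are those left by the previous
  stage and whose remaining rows are still untouched. The \<open>fold\<close> eliminates with the rows
  \<open>0, 1, \<dots>, n - 1\<close> in this order.\<close>

definition gj_stage :: "nat \<Rightarrow> 'a::field rf_matrix \<Rightarrow> 'a rf_matrix" where
  "gj_stage n M =
     (let G = normalize_row (fold (\<lambda>i v. eliminate (M i) v) [0..<n] (M n))
      in (\<lambda>k. if k < n then eliminate G (M k) else if k = n then G else M k))"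

text \<open>\<open>gauss_jordan C n\<close> is the matrix before stage \<open>n\<close>: for \<open>k \<le> n\<close>, the vector \<open>L\<^sub>k\<close> at the
  end of stage \<open>n\<close> is \<open>gauss_jordan C (Suc n) k\<close>.\<close>

primrec gauss_jordan :: "'a::field rf_matrix \<Rightarrow> nat \<Rightarrow> 'a rf_matrix" where
  "gauss_jordan C 0 = C"
| "gauss_jordan C (Suc n) = gj_stage n (gauss_jordan C n)"

text \<open>Row \<open>k\<close> is the eventual value of the eventually constant sequence of its successive values.\<close>

definition gauss_jordan_result :: "'a::field rf_matrix \<Rightarrow> 'a rf_matrix" where
  "gauss_jordan_result C =
     (\<lambda>k. THE v. eventually (\<lambda>n. gauss_jordan C n k = v) sequentially)"


section \<open>Reordering routine\<close>

definition reorder :: "'a::field row_seq \<Rightarrow> 'a row_seq" where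
  "reorder A =
     (let ps = sorted_list_of_set {k \<in> dom A. A k \<noteq> Some 0}
      in A(ps [\<mapsto>] sort_key row_length (map (\<lambda>k. the (A k)) ps)))"

text \<open>The matrix each of whose top submatrices is the eventual value of the corresponding top
  submatrices of the finite reorderings.\<close>

definition reorder_result :: "'a::field rf_matrix \<Rightarrow> 'a rf_matrix" where
  "reorder_result L =
     (THE H. \<forall>k. eventually
        (\<lambda>n. top_submatrix (reorder (top_submatrix (Some \<circ> L) n)) k = top_submatrix (Some \<circ> H) k)
        sequentially)"

end

theory Submission
  imports Defs "HOL-Library.Infinite_Set"
begin

text \<open>
  Everything rests on one observation about the order of pivots. When stage \<open>n\<close> subtracts a nonzero
  multiple of its new row \<open>G\<^sub>n\<close> from an earlier row \<open>k\<close>, the pivot of \<open>G\<^sub>n\<close> lies strictly to the left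
  of the pivot of row \<open>k\<close>: it cannot lie beyond the pivot of row \<open>k\<close>, where row \<open>k\<close> vanishes,
  and it is not equal to it, because the elimination has cleared \<open>G\<^sub>n\<close> in that column
  (\<open>jordan_coeff_nonzero\<close>). Hence the pivot of row \<open>k\<close> never moves. As pivots of different rows
  are different, only finitely many stages can produce a pivot to the left of a given column
  (\<open>finite_small_pivots\<close>), so each row changes only finitely often and the process converges
  (\<open>gauss_jordan_converges\<close>).

  The same bound yields invertibility. The matrix before stage \<open>n\<close> is \<open>T\<^sub>n \<cdot> C\<close> with an invertible
  row-finite \<open>T\<^sub>n\<close>. The rows of \<open>T\<^sub>n\<close> stabilize as the rows of the matrix do. A row of the inverse
  \<open>S\<^sub>n\<close> changes at stage \<open>n\<close> only if its support contains a row index whose pivot is larger than that of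
  \<open>G\<^sub>n\<close>; it then acquires the index \<open>n\<close> only, so the largest pivot over its support never grows, and it
  stabilizes too. Matrix multiplication commutes with row-wise limits, since a row of a product involves
  finitely many rows (\<open>rows_converge_rf_mult\<close>). Therefore the limits of \<open>T\<^sub>n\<close> and \<open>S\<^sub>n\<close> are inverse
  to each other, and the limit \<open>L\<close> of the process is an invertible multiple of \<open>C\<close>
  (\<open>gauss_jordan_result_transform\<close>).

  In \<open>L\<close> every pivot column has its pivot as only nonzero entry. Reordering by length is a permutation
  of \<open>\<omega>\<close>: a set of natural numbers is order isomorphic to the set of (distinct) pivots attached
  to it, so there is a permutation \<open>\<pi>\<close>, fixing the indices of zero rows, for which the pivots of
  \<open>L \<circ> \<pi>\<close> increase (\<open>ex_sorting_permutation\<close>). As soon as \<open>n\<close> is at least \<open>k\<close> and all of \<open>\<pi> 0, \<dots>, \<pi> k\<close>, the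
  shortest rows of \<open>L|\<^sub>n\<close> are those that \<open>\<pi>\<close> places first, so the sorted
  \<open>L|\<^sub>n\<close> agrees with \<open>L \<circ> \<pi>\<close> up to row \<open>k\<close> (\<open>reorder_stabilizes\<close>). Thus \<open>H = L \<circ> \<pi>\<close>, which is a
  quasi-Hermite form of \<open>C\<close>. The chain of submatrices follows because a finite sequence with rows
  \<open>0, \<dots>, n\<close> that is contained in \<open>H\<close> can only be \<open>H|\<^sub>n\<close>.
\<close>

abbreviation entry :: "'a::zero row \<Rightarrow> nat \<Rightarrow> 'a" where
  "entry \<equiv> Poly_Mapping.lookup"

abbreviation support :: "'a::zero row \<Rightarrow> nat set" where
  "support \<equiv> Poly_Mapping.keys"

abbreviation unit_row :: "nat \<Rightarrow> 'a::zero_neq_one row" where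
  "unit_row k \<equiv> Poly_Mapping.single k 1"

section \<open>Linear algebra of row-finite matrices\<close>

lemma entry_scale_row [simp]: "entry (scale_row c x) k = c * entry x k"
  by (simp add: scale_row_def Poly_Mapping.map.rep_eq when_def)

lemma scale_row_simps [simp]:
  "scale_row 0 x = 0" "scale_row c 0 = 0" "scale_row 1 x = x"
  "scale_row a (scale_row b x) = scale_row (a * b) x"
  by (auto intro!: poly_mapping_eqI simp: mult.assoc)

lemma scale_row_algebra:
  "scale_row c (x + y) = scale_row c x + scale_row c y"
  "scale_row c (x - y) = scale_row c x - scale_row c y"
  "scale_row (a + b) x = scale_row a x + scale_row b x"
  "scale_row (a - b) x = scale_row a x - scale_row b x"
  "scale_row (- a) x = - scale_row a x"
  by (auto intro!: poly_mapping_eqI simp: algebra_simps lookup_add lookup_minus)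

lemma scale_row_sum: "scale_row c (sum f A) = (\<Sum>a\<in>A. scale_row c (f a))"
  by (induction A rule: infinite_finite_induct) (auto simp: scale_row_algebra)

text \<open>
  The product of a row and a matrix. Reducing the matrix product to it turns
  associativity into linearity in the row.
\<close>

definition row_mult :: "'a::field row \<Rightarrow> 'a rf_matrix \<Rightarrow> 'a row" where
  "row_mult x M = (\<Sum>k\<in>support x. scale_row (entry x k) (M k))"

lemma rf_mult_row: "rf_mult A B k = row_mult (A k) B"
  by (simp add: rf_mult_def row_mult_def)

lemma row_mult_superset:
  assumes "finite K" "support x \<subseteq> K"
  shows "row_mult x M = (\<Sum>k\<in>K. scale_row (entry x k) (M k))"
  unfolding row_mult_def using assms
  by (intro sum.mono_neutral_left) (auto simp: in_keys_iff)

lemma row_mult_add: "row_mult (x + y) M = row_mult x M + row_mult y M"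
proof -
  let ?K = "support x \<union> support y"
  have "row_mult z M = (\<Sum>k\<in>?K. scale_row (entry z k) (M k))" if "z \<in> {x, y, x + y}" for z
    using that Poly_Mapping.keys_add[of x y] by (intro row_mult_superset) auto
  then show ?thesis
    by (simp add: lookup_add scale_row_algebra sum.distrib)
qed

lemma row_mult_scale: "row_mult (scale_row c x) M = scale_row c (row_mult x M)"
proof -
  have "row_mult (scale_row c x) M = (\<Sum>k\<in>support x. scale_row (entry (scale_row c x) k) (M k))"
    by (rule row_mult_superset) (auto simp: in_keys_iff)
  then show ?thesis by (simp add: row_mult_def scale_row_sum)
qed

lemma row_mult_0 [simp]: "row_mult 0 M = 0"
  by (simp add: row_mult_def)

lemma row_mult_diff: "row_mult (x - y) M = row_mult x M - row_mult y M"
  using row_mult_add[of "x - y" y M] by (simp add: algebra_simps)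

lemma row_mult_sum: "row_mult (sum f A) M = (\<Sum>a\<in>A. row_mult (f a) M)"
  by (induction A rule: infinite_finite_induct) (auto simp: row_mult_add)

lemma row_mult_unit_row [simp]: "row_mult (unit_row k) M = M k"
  by (simp add: row_mult_def)

lemma row_mult_rf_one [simp]: "row_mult x rf_one = x"
proof (rule poly_mapping_eqI)
  fix j
  have "entry (row_mult x rf_one) j = (\<Sum>k\<in>support x. entry x k * (1 when k = j))"
    by (simp add: row_mult_def rf_one_def lookup_sum lookup_single)
  also have "\<dots> = (\<Sum>k\<in>support x. if k = j then entry x k else 0)"
    by (intro sum.cong) (auto simp: when_def)
  finally show "entry (row_mult x rf_one) j = entry x j"
    by (auto simp: in_keys_iff)
qed

lemma row_mult_assoc: "row_mult (row_mult x A) B = row_mult x (rf_mult A B)"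
  by (simp add: row_mult_def[of x] row_mult_sum row_mult_scale rf_mult_row)

lemma rf_mult_assoc: "rf_mult (rf_mult A B) C = rf_mult A (rf_mult B C)"
  by (rule ext) (simp add: rf_mult_row row_mult_assoc)

lemma rf_mult_one [simp]: "rf_mult A rf_one = A" "rf_mult rf_one A = A"
  by (simp_all add: fun_eq_iff rf_mult_row rf_one_def[THEN fun_cong])

definition inverse_pair :: "'a::field rf_matrix \<Rightarrow> 'a rf_matrix \<Rightarrow> bool" where
  "inverse_pair A B \<longleftrightarrow> rf_mult A B = rf_one \<and> rf_mult B A = rf_one"

lemma inverse_pair_mult:
  assumes "inverse_pair A A'" "inverse_pair B B'"
  shows "inverse_pair (rf_mult A B) (rf_mult B' A')"
proof -
  have "rf_mult (rf_mult A B) (rf_mult B' A') = rf_mult A (rf_mult (rf_mult B B') A')"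
    "rf_mult (rf_mult B' A') (rf_mult A B) = rf_mult B' (rf_mult (rf_mult A' A) B)"
    by (simp_all only: rf_mult_assoc)
  with assms show ?thesis by (simp add: inverse_pair_def)
qed

lemma inverse_pair_permutation:
  assumes "bij \<pi>"
  shows "inverse_pair (\<lambda>k. unit_row (\<pi> k)) (\<lambda>k. unit_row (inv \<pi> k))"
  using assms
  by (auto simp: inverse_pair_def fun_eq_iff rf_mult_row rf_one_def bij_is_inj bij_is_surj surj_f_inv_f)

subsection \<open>Rank-one updates of the identity\<close>

definition rank_one_update :: "(nat \<Rightarrow> 'a::field) \<Rightarrow> 'a row \<Rightarrow> 'a rf_matrix" where
  "rank_one_update f v = (\<lambda>k. unit_row k + scale_row (f k) v)"

text \<open>
  The column \<open>f\<close> may have infinitely many nonzero entries; the pairing is finite because the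
  row \<open>x\<close> is.
\<close>

definition pairing :: "'a::field row \<Rightarrow> (nat \<Rightarrow> 'a) \<Rightarrow> 'a" where
  "pairing x f = (\<Sum>k\<in>support x. entry x k * f k)"

lemma pairing_scale_right: "pairing x (\<lambda>k. c * f k) = c * pairing x f"
  by (simp add: pairing_def sum_distrib_left algebra_simps)

lemma pairing_unit_row [simp]: "pairing (unit_row k) f = f k"
  by (simp add: pairing_def)

lemma rf_mult_rank_one_update:
  "rf_mult (rank_one_update f v) M k = M k + scale_row (f k) (row_mult v M)"
  by (simp add: rf_mult_row rank_one_update_def row_mult_add row_mult_scale)

lemma row_mult_rank_one_update:
  "row_mult x (rank_one_update f v) = x + scale_row (pairing x f) v"
proof -
  have "row_mult x (rank_one_update f v)
      = row_mult x rf_one + (\<Sum>k\<in>support x. scale_row (entry x k * f k) v)"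
    by (simp add: row_mult_def rank_one_update_def scale_row_algebra sum.distrib rf_one_def
        del: row_mult_rf_one)
  also have "(\<Sum>k\<in>support x. scale_row (entry x k * f k) v) = scale_row (pairing x f) v"
    unfolding pairing_def
    by (induction "support x" rule: infinite_finite_induct)
       (auto intro!: poly_mapping_eqI simp: lookup_sum sum_distrib_right)
  finally show ?thesis by simp
qed

text \<open>
  The Sherman--Morrison formula: \<open>(1 + f v)\<inverse> = 1 - f v / (1 + \<langle>v, f\<rangle>)\<close>. Both halves of an
  elimination stage are rank-one updates: replacing row \<open>n\<close> by a combination of rows, and adding
  multiples of row \<open>n\<close> to the rows above it.
\<close>

lemma inverse_pair_rank_one_update:
  assumes "1 + pairing v f \<noteq> 0"
  shows "inverse_pair (rank_one_update f v) (rank_one_update (\<lambda>k. - inverse (1 + pairing v f) * f k) v)"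
proof -
  let ?c = "inverse (1 + pairing v f)"
  have *: "f k + - ?c * f k + f k * (- ?c * pairing v f) = 0" for k
    using assms by (simp add: field_simps)
  have "unit_row k + scale_row (- ?c * f k) v + scale_row (f k) (v + scale_row (- ?c * pairing v f) v) = unit_row k"
    "unit_row k + scale_row (f k) v + scale_row (- ?c * f k) (v + scale_row (pairing v f) v) = unit_row k"
    for k
    using *[of k] assms
    by (auto intro!: poly_mapping_eqI simp: lookup_add field_simps)
  then show ?thesis
    unfolding inverse_pair_def fun_eq_iff rf_mult_rank_one_update row_mult_rank_one_update
      pairing_scale_right
    by (simp add: rank_one_update_def rf_one_def)
qed

section \<open>Row-wise limits\<close>

text \<open>
  Convergence in the product topology of the discrete space of rows.
\<close>

definition rows_converge :: "(nat \<Rightarrow> 'a::zero rf_matrix) \<Rightarrow> 'a rf_matrix \<Rightarrow> bool" where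
  "rows_converge X Y \<longleftrightarrow> (\<forall>k. \<forall>\<^sub>F n in sequentially. X n k = Y k)"

lemma rows_converge_const: "rows_converge (\<lambda>_. A) A"
  by (simp add: rows_converge_def)

lemma rows_converge_unique:
  assumes "rows_converge X Y" "rows_converge X Z"
  shows "Y = Z"
proof
  fix k
  have "\<forall>\<^sub>F n in sequentially. X n k = Y k" "\<forall>\<^sub>F n in sequentially. X n k = Z k"
    using assms by (auto simp: rows_converge_def)
  then have "\<forall>\<^sub>F n in sequentially. Y k = Z k" by eventually_elim simp
  then show "Y k = Z k" by simp
qed

text \<open>
  Row \<open>k\<close> of the product involves only the rows of the right factor that are indexed by the finite
  support of row \<open>k\<close> of the left factor, so finitely many stabilizations decide it.
\<close>

lemma rows_converge_rf_mult:
  assumes X: "rows_converge X Y" and X': "rows_converge X' Y'"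
  shows "rows_converge (\<lambda>n. rf_mult (X n) (X' n)) (rf_mult Y Y')"
  unfolding rows_converge_def
proof
  fix k
  have "\<forall>\<^sub>F n in sequentially. \<forall>j\<in>support (Y k). X' n j = Y' j"
    using X' by (intro eventually_ball_finite) (auto simp: rows_converge_def)
  moreover have "\<forall>\<^sub>F n in sequentially. X n k = Y k"
    using X by (simp add: rows_converge_def)
  ultimately show "\<forall>\<^sub>F n in sequentially. rf_mult (X n) (X' n) k = rf_mult Y Y' k"
    by eventually_elim (simp add: rf_mult_row row_mult_def)
qed

text \<open>
  Convergence of the inverses has to be assumed: the cyclic shifts of the first \<open>n\<close> unit rows
  converge to the infinite shift, which is not invertible.
\<close>

lemma inverse_pair_limit:
  assumes "rows_converge T T'" "rows_converge S S'" "\<And>n. inverse_pair (T n) (S n)"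
  shows "inverse_pair T' S'"
  using rows_converge_rf_mult[OF assms(1,2)] rows_converge_rf_mult[OF assms(2,1)] assms(3)
  by (auto simp: inverse_pair_def intro: rows_converge_unique rows_converge_const)

lemma finite_changes_imp_eventually_constant:
  fixes X :: "nat \<Rightarrow> 'b"
  assumes "finite {n. X (Suc n) \<noteq> X n}"
  shows "\<exists>y. \<forall>\<^sub>F n in sequentially. X n = y"
proof -
  from assms obtain N where "\<And>n. X (Suc n) \<noteq> X n \<Longrightarrow> n \<le> N"
    by (auto simp: finite_nat_set_iff_bounded_le)
  then have step: "X (Suc n) = X n" if "n \<ge> Suc N" for n using that by force
  have "X n = X (Suc N)" if "Suc N \<le> n" for n
    using that by (induction n rule: nat_induct_at_least) (auto simp: step)
  then show ?thesis by (auto simp: eventually_sequentially)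
qed

lemma rows_convergeI:
  assumes "\<And>k. finite {n. X (Suc n) k \<noteq> X n k}"
  shows "\<exists>Y. rows_converge X Y"
  using finite_changes_imp_eventually_constant[OF assms] unfolding rows_converge_def by metis


section \<open>Pivots and the elimination step\<close>

lemma
  assumes "x \<noteq> 0"
  shows row_length_nonzero: "row_length x = int (pivot x)"
    and entry_pivot: "entry x (pivot x) \<noteq> 0"
    and entry_beyond_pivot: "pivot x < k \<Longrightarrow> entry x k = 0"
proof -
  have p: "pivot x = Max (support x)" and "support x \<noteq> {}"
    using assms by (auto simp: pivot_def row_length_def)
  then show "row_length x = int (pivot x)" "entry x (pivot x) \<noteq> 0"
    using assms Max_in[of "support x"] by (auto simp: row_length_def in_keys_iff)
  show "entry x k = 0" if "pivot x < k"
    using that p Max_ge[of "support x" k] by (fastforce simp: in_keys_iff)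
qed

lemma pivot_eqI:
  assumes "entry x p \<noteq> 0" "\<And>k. p < k \<Longrightarrow> entry x k = 0"
  shows "pivot x = p"
proof -
  have "x \<noteq> 0" using assms(1) by auto
  then show ?thesis
    using assms entry_pivot[of x] entry_beyond_pivot[of x] by (metis linorder_neqE_nat)
qed

lemma entry_eliminate:
  "entry (eliminate r v) k = entry v k - (if r = 0 then 0 else entry v (pivot r) * entry r k)"
  by (simp add: eliminate_def lookup_minus)

lemma eliminate_zero [simp]: "eliminate r 0 = 0"
  by (simp add: eliminate_def)

text \<open>
  If \<open>r\<close> vanishes in the pivot column of \<open>v\<close> but is used to change \<open>v\<close>, its own pivot lies
  strictly to the left of that of \<open>v\<close>, so the end of \<open>v\<close> is not affected.
\<close>

lemma eliminate_preserves_pivot: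
  assumes "v \<noteq> 0" "entry r (pivot v) = 0"
  shows "eliminate r v \<noteq> 0" "pivot (eliminate r v) = pivot v"
    "entry (eliminate r v) (pivot v) = entry v (pivot v)"
proof -
  show e: "entry (eliminate r v) (pivot v) = entry v (pivot v)"
    by (simp add: entry_eliminate assms(2))
  then show "eliminate r v \<noteq> 0"
    using entry_pivot[OF assms(1)] by auto
  have "entry (eliminate r v) k = 0" if "pivot v < k" for k
  proof (cases "r = 0 \<or> entry v (pivot r) = 0")
    case False
    then have "pivot r \<le> pivot v"
      using entry_beyond_pivot[OF assms(1)] linorder_not_less by blast
    with False that show ?thesis
      by (simp add: entry_eliminate entry_beyond_pivot[OF assms(1)] entry_beyond_pivot)
  qed (use that in \<open>auto simp: entry_eliminate entry_beyond_pivot[OF assms(1)]\<close>)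
  then show "pivot (eliminate r v) = pivot v"
    using e entry_pivot[OF assms(1)] by (intro pivot_eqI) auto
qed

lemma normalize_row_scale: "\<exists>c. c \<noteq> 0 \<and> normalize_row v = scale_row c v"
proof (cases "v = 0")
  case False
  then show ?thesis
    using entry_pivot[of v]
    by (intro exI[of _ "inverse (entry v (pivot v))"]) (auto simp: normalize_row_def)
qed (auto simp: normalize_row_def intro: exI[of _ 1])

lemma entry_pivot_normalize_row:
  assumes "normalize_row v \<noteq> 0"
  shows "entry (normalize_row v) (pivot (normalize_row v)) = 1"
proof -
  have v: "v \<noteq> 0" using assms by (auto simp: normalize_row_def)
  then have "pivot (normalize_row v) = pivot v"
    by (intro pivot_eqI) (auto simp: normalize_row_def entry_pivot entry_beyond_pivot)
  then show ?thesis using v by (simp add: normalize_row_def entry_pivot)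
qed

text \<open>
  The invariant of the algorithm: among the first \<open>n\<close> rows, a pivot is \<open>1\<close> and is the only nonzero
  entry of its column.
\<close>

definition reduced_below :: "nat \<Rightarrow> 'a::field rf_matrix \<Rightarrow> bool" where
  "reduced_below n M \<longleftrightarrow>
     (\<forall>i<n. M i \<noteq> 0 \<longrightarrow> entry (M i) (pivot (M i)) = 1 \<and>
        (\<forall>j<n. j \<noteq> i \<longrightarrow> entry (M j) (pivot (M i)) = 0))"

text \<open>
  The vector \<open>G\<^sub>n\<close> that stage \<open>n\<close> computes from the matrix \<open>M\<close> before it.
\<close>

definition new_row :: "nat \<Rightarrow> 'a::field rf_matrix \<Rightarrow> 'a row" where
  "new_row n M = normalize_row (fold (\<lambda>i v. eliminate (M i) v) [0..<n] (M n))"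

lemma gj_stage_row:
  "gj_stage n M k = (if k < n then eliminate (new_row n M) (M k) else if k = n then new_row n M else M k)"
  by (simp add: gj_stage_def new_row_def Let_def)

text \<open>
  Elimination subtracts multiples of the rows before \<open>n\<close> only, so row \<open>n\<close> keeps coefficient \<open>1\<close>
  until the normalization multiplies it by a nonzero scalar. That the coefficient at \<open>n\<close> does not vanish
  makes the replacement of row \<open>n\<close> by \<open>G\<^sub>n\<close> invertible.
\<close>

lemma new_row_combination:
  "\<exists>x. entry x n \<noteq> 0 \<and> support x \<subseteq> {..n} \<and> new_row n M = row_mult x M"
proof -
  have "\<exists>x. entry x n \<noteq> 0 \<and> support x \<subseteq> {..n} \<and>
          fold (\<lambda>i v. eliminate (M i) v) [0..<m] (M n) = row_mult x M" if "m \<le> n" for m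
    using that
  proof (induction m)
    case 0
    then show ?case by (intro exI[of _ "unit_row n"]) auto
  next
    case (Suc m)
    then obtain x where x: "entry x n \<noteq> 0" "support x \<subseteq> {..n}"
      and f: "fold (\<lambda>i v. eliminate (M i) v) [0..<m] (M n) = row_mult x M"
      by auto
    define c where "c = (if M m = 0 then 0 else entry (row_mult x M) (pivot (M m)))"
    define y where "y = x - scale_row c (unit_row m)"
    have "entry y n \<noteq> 0" "support y \<subseteq> {..n}"
      using x Suc.prems unfolding y_def
      by (auto simp: lookup_minus lookup_single when_def in_keys_iff subset_iff split: if_splits)
    moreover have "fold (\<lambda>i v. eliminate (M i) v) [0..<Suc m] (M n) = row_mult y M"
      by (simp add: f, simp add: y_def c_def row_mult_diff row_mult_scale eliminate_def)
    ultimately show ?case by blast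
  qed
  from this[of n] obtain x where x: "entry x n \<noteq> 0" "support x \<subseteq> {..n}"
    "fold (\<lambda>i v. eliminate (M i) v) [0..<n] (M n) = row_mult x M" by auto
  obtain c where c: "c \<noteq> 0" "new_row n M = scale_row c (row_mult x M)"
    using normalize_row_scale x(3) by (metis new_row_def)
  show ?thesis
    using x c by (intro exI[of _ "scale_row c x"]) (auto simp: row_mult_scale in_keys_iff)
qed

lemma entry_pivot_new_row: "new_row n M \<noteq> 0 \<Longrightarrow> entry (new_row n M) (pivot (new_row n M)) = 1"
  by (simp add: new_row_def entry_pivot_normalize_row)

text \<open>
  Eliminating with row \<open>i\<close> clears its pivot column, and later eliminations do not spoil it because
  the other rows vanish in that column.
\<close>

lemma new_row_at_old_pivot:
  assumes "reduced_below n M" "i < n" "M i \<noteq> 0"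
  shows "entry (new_row n M) (pivot (M i)) = 0"
proof -
  have "entry (fold (\<lambda>i v. eliminate (M i) v) [0..<m] v) (pivot (M i)) = 0"
    if "i < m" "m \<le> n" for m v
    using that
  proof (induction m)
    case (Suc m)
    show ?case
    proof (cases "i = m")
      case True
      then show ?thesis using assms by (simp add: entry_eliminate reduced_below_def)
    next
      case False
      then show ?thesis
        using assms Suc by (auto simp: entry_eliminate reduced_below_def)
    qed
  qed simp
  from this[of n] show ?thesis
    using assms(2) normalize_row_scale unfolding new_row_def by (metis entry_scale_row mult_zero_right order_refl)
qed

lemma reduced_below_gj_stage:
  assumes "reduced_below n M"
  shows "reduced_below (Suc n) (gj_stage n M)"
proof -
  let ?G = "new_row n M" and ?M = "gj_stage n M"
  have G: "entry (?M j) (pivot ?G) = 0" if "?G \<noteq> 0" "j < n" for j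
    using that by (simp add: gj_stage_row entry_eliminate entry_pivot_new_row)
  have old: "?M i \<noteq> 0 \<Longrightarrow> M i \<noteq> 0" if "i < n" for i
    using that by (auto simp: gj_stage_row)
  have piv: "pivot (?M i) = pivot (M i)" "entry (?M i) (pivot (M i)) = 1"
    if "i < n" "M i \<noteq> 0" for i
    using that assms eliminate_preserves_pivot[of "M i" ?G] new_row_at_old_pivot[OF assms]
    by (auto simp: gj_stage_row reduced_below_def)
  have off: "entry (?M j) (pivot (M i)) = 0" if "i < n" "M i \<noteq> 0" "j \<le> n" "j \<noteq> i" for i j
    using that assms new_row_at_old_pivot[OF assms, of i]
    by (auto simp: gj_stage_row entry_eliminate reduced_below_def)
  have Gn: "?M n = ?G" by (simp add: gj_stage_row)
  show ?thesis
    unfolding reduced_below_def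
  proof (intro allI impI conjI)
    fix i assume i: "i < Suc n" "?M i \<noteq> 0"
    show "entry (?M i) (pivot (?M i)) = 1"
      using i piv old Gn entry_pivot_new_row[of n M] by (cases "i = n") auto
    fix j assume j: "j < Suc n" "j \<noteq> i"
    show "entry (?M j) (pivot (?M i)) = 0"
    proof (cases "i = n")
      case True
      then show ?thesis using i j G Gn by simp
    next
      case False
      then show ?thesis using i j off[of i j] piv(1)[of i] old[of i] by simp
    qed
  qed
qed

section \<open>The infinite elimination process\<close>

lemma reduced_below_gauss_jordan: "reduced_below n (gauss_jordan C n)"
  by (induction n) (auto simp: reduced_below_gj_stage, simp add: reduced_below_def)

text \<open>
  The same \<open>G\<^sub>n\<close>, now as part of the run on \<open>C\<close>. By \<open>gauss_jordan_keeps_pivot\<close> it determines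
  the pivot of row \<open>n\<close> once and for all.
\<close>

definition entering_row :: "'a::field rf_matrix \<Rightarrow> nat \<Rightarrow> 'a row" where
  "entering_row C n = gauss_jordan C (Suc n) n"

lemma entering_row_eq_new_row: "entering_row C n = new_row n (gauss_jordan C n)"
  by (simp add: entering_row_def gj_stage_row)

lemma gauss_jordan_keeps_pivot:
  assumes "k < n"
  shows "gauss_jordan C n k = 0 \<longleftrightarrow> entering_row C k = 0"
    and "pivot (gauss_jordan C n k) = pivot (entering_row C k)"
proof -
  have "(gauss_jordan C n k = 0 \<longleftrightarrow> entering_row C k = 0) \<and>
    pivot (gauss_jordan C n k) = pivot (entering_row C k)"
    if "Suc k \<le> n" for n
    using that
  proof (induction n rule: nat_induct_at_least)
    case base
    then show ?case by (simp add: entering_row_def)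
  next
    case (Suc n)
    let ?M = "gauss_jordan C n"
    show ?case
    proof (cases "?M k = 0")
      case True
      then show ?thesis using Suc by (simp add: gj_stage_row)
    next
      case False
      have "entry (new_row n ?M) (pivot (?M k)) = 0"
        using Suc.hyps False by (intro new_row_at_old_pivot reduced_below_gauss_jordan) auto
      from eliminate_preserves_pivot[OF False this] show ?thesis
        using Suc False by (simp add: gj_stage_row)
    qed
  qed
  then show "gauss_jordan C n k = 0 \<longleftrightarrow> entering_row C k = 0"
    and "pivot (gauss_jordan C n k) = pivot (entering_row C k)"
    using assms by auto
qed

lemma entering_pivots_distinct:
  "inj_on (\<lambda>n. pivot (entering_row C n)) {n. entering_row C n \<noteq> 0}"
proof -
  have "pivot (entering_row C i) \<noteq> pivot (entering_row C j)"
    if "entering_row C i \<noteq> 0" "entering_row C j \<noteq> 0" "i < j" for i j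
  proof -
    let ?M = "gauss_jordan C (Suc j)"
    have nz: "?M i \<noteq> 0" "?M j \<noteq> 0"
      using that gauss_jordan_keeps_pivot(1)[of _ "Suc j" C] by (metis less_Suc_eq)+
    then have "entry (?M i) (pivot (?M j)) = 0" "entry (?M i) (pivot (?M i)) = 1"
      using reduced_below_gauss_jordan[of "Suc j" C] that
      by (auto simp: reduced_below_def simp del: gauss_jordan.simps)
    then show ?thesis
      using that gauss_jordan_keeps_pivot(2)[of _ "Suc j" C] by (metis less_Suc_eq zero_neq_one)
  qed
  then show ?thesis unfolding inj_on_def by (metis (mono_tags) linorder_neqE_nat mem_Collect_eq)
qed

text \<open>
  Pivots are distinct natural numbers, so only finitely many of them are below \<open>b\<close>. This is the
  source of all convergence statements.
\<close>

lemma finite_small_pivots: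
  "finite {n. entering_row C n \<noteq> 0 \<and> pivot (entering_row C n) < b}"
  by (rule inj_on_finite[OF inj_on_subset[OF entering_pivots_distinct], of _ C "{..<b}"]) auto

text \<open>
  The multiple of \<open>G\<^sub>n\<close> that stage \<open>n\<close> subtracts from row \<open>k\<close>. It is \<open>0\<close> outside the Jordan
  elimination, in particular for \<open>k = n\<close>, so that one formula covers all rows other than \<open>n\<close>.
\<close>

definition jordan_coeff :: "'a::field rf_matrix \<Rightarrow> nat \<Rightarrow> nat \<Rightarrow> 'a" where
  "jordan_coeff C n k = (if k < n \<and> entering_row C n \<noteq> 0
     then entry (gauss_jordan C n k) (pivot (entering_row C n)) else 0)"

lemma gauss_jordan_Suc_row:
  "gauss_jordan C (Suc n) k =
     (if k = n then entering_row C n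
      else gauss_jordan C n k - scale_row (jordan_coeff C n k) (entering_row C n))"
  by (simp add: gj_stage_row jordan_coeff_def eliminate_def flip: entering_row_eq_new_row)

text \<open>
  Row \<open>k\<close> has a nonzero entry in the pivot column of \<open>G\<^sub>n\<close>, so that column is at most the pivot of
  row \<open>k\<close>; equality is excluded because \<open>G\<^sub>n\<close> vanishes in the pivot column of row \<open>k\<close>.
\<close>

lemma jordan_coeff_nonzero:
  assumes "jordan_coeff C n k \<noteq> 0"
  shows "entering_row C n \<noteq> 0" "entering_row C k \<noteq> 0"
    "pivot (entering_row C n) < pivot (entering_row C k)"
proof -
  let ?M = "gauss_jordan C n" and ?G = "entering_row C n"
  have kn: "k < n" and G: "?G \<noteq> 0" and e: "entry (?M k) (pivot ?G) \<noteq> 0"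
    using assms by (auto simp: jordan_coeff_def split: if_splits)
  then have nz: "?M k \<noteq> 0" by auto
  have "entry ?G (pivot (?M k)) = 0"
    unfolding entering_row_eq_new_row
    using kn nz by (intro new_row_at_old_pivot reduced_below_gauss_jordan)
  then have "pivot ?G \<noteq> pivot (?M k)" using entry_pivot[OF G] by metis
  moreover have "pivot ?G \<le> pivot (?M k)"
    using e entry_beyond_pivot[OF nz] linorder_not_less by blast
  ultimately show "pivot ?G < pivot (entering_row C k)"
    using gauss_jordan_keeps_pivot(2)[OF kn, of C] by simp
  show "?G \<noteq> 0" "entering_row C k \<noteq> 0"
    using G nz gauss_jordan_keeps_pivot(1)[OF kn, of C] by auto
qed

lemma finite_jordan_coeff: "finite {n. jordan_coeff C n k \<noteq> 0}"
  by (rule finite_subset[OF _ finite_small_pivots[of C "pivot (entering_row C k)"]])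
     (auto dest: jordan_coeff_nonzero)

lemma gauss_jordan_converges: "rows_converge (gauss_jordan C) (gauss_jordan_result C)"
proof -
  have "finite {n. gauss_jordan C (Suc n) k \<noteq> gauss_jordan C n k}" for k
    by (rule finite_subset[of _ "insert k {n. jordan_coeff C n k \<noteq> 0}"])
       (auto simp: finite_jordan_coeff gauss_jordan_Suc_row simp del: gauss_jordan.simps)
  then obtain L where L: "rows_converge (gauss_jordan C) L"
    using rows_convergeI by blast
  have "gauss_jordan_result C k = L k" for k
    unfolding gauss_jordan_result_def
  proof (rule the_equality)
    show L_k: "\<forall>\<^sub>F n in sequentially. gauss_jordan C n k = L k"
      using L by (simp add: rows_converge_def)
    fix v assume "\<forall>\<^sub>F n in sequentially. gauss_jordan C n k = v"
    with L_k have "\<forall>\<^sub>F n in sequentially. v = L k" by eventually_elim simp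
    then show "v = L k" by simp
  qed
  then have "gauss_jordan_result C = L" by blast
  then show ?thesis using L by simp
qed

text \<open>
  Stage \<open>n\<close> is left multiplication by \<open>B\<^sub>n \<cdot> A\<^sub>n\<close>, where \<open>A\<^sub>n\<close> replaces row \<open>n\<close> by
  \<open>G\<^sub>n\<close> and \<open>B\<^sub>n\<close> performs the Jordan elimination. The products \<open>T\<close> of these matrices and the
  products \<open>S\<close> of their inverses are followed side by side, and both converge row by row.
\<close>

theorem gauss_jordan_result_transform:
  fixes C :: "'a::field rf_matrix"
  shows "\<exists>T S. inverse_pair T S \<and> gauss_jordan_result C = rf_mult T C"
proof -
  let ?G = "entering_row C" and ?d = "jordan_coeff C"
  let ?\<delta> = "\<lambda>n k. if k = n then 1 else 0 :: 'a"
  have "\<forall>n. \<exists>x. entry x n \<noteq> 0 \<and> support x \<subseteq> {..n} \<and> ?G n = row_mult x (gauss_jordan C n)"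
    unfolding entering_row_eq_new_row using new_row_combination by blast
  then obtain x where x: "\<And>n. entry (x n) n \<noteq> 0" "\<And>n. support (x n) \<subseteq> {..n}"
    "\<And>n. ?G n = row_mult (x n) (gauss_jordan C n)" by metis
  \<comment> \<open>\<open>A n\<close> puts \<open>x n\<close> in place of unit row \<open>n\<close>, and \<open>1 + \<langle>v n, \<delta>\<^sub>n\<rangle>\<close> is the coefficient of
    \<open>x n\<close> at \<open>n\<close>, which is nonzero.\<close>
  define v where "v n = x n - unit_row n" for n
  define A where "A n = rank_one_update (?\<delta> n) (v n)" for n
  define B where "B n = rank_one_update (\<lambda>k. - ?d n k) (unit_row n)" for n
  define B' where "B' n = rank_one_update (?d n) (unit_row n)" for n
  have pair_\<delta>: "pairing z (?\<delta> n) = entry z n" for z n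
    by (auto simp: pairing_def in_keys_iff if_distrib cong: if_cong)
  have "\<exists>c. inverse_pair (A n) (rank_one_update (\<lambda>k. c * ?\<delta> n k) (v n))" for n
    unfolding A_def
    by (rule exI, rule inverse_pair_rank_one_update) (simp add: pair_\<delta> v_def lookup_minus x(1))
  then obtain c where c: "\<And>n. inverse_pair (A n) (rank_one_update (\<lambda>k. c n * ?\<delta> n k) (v n))"
    by metis
  define A' where "A' n = rank_one_update (\<lambda>k. c n * ?\<delta> n k) (v n)" for n
  have A'_row: "row_mult z (A' n) = z + scale_row (c n * entry z n) (v n)" for z n
    unfolding A'_def row_mult_rank_one_update pairing_scale_right pair_\<delta> ..
  have B'_row: "row_mult z (B' n) = z + scale_row (pairing z (?d n)) (unit_row n)" for z n
    by (simp add: B'_def row_mult_rank_one_update)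
  have dn: "?d n n = 0" for n by (simp add: jordan_coeff_def)
  have "inverse_pair (A n) (A' n)" for n
    using c by (simp add: A'_def)
  moreover have "inverse_pair (B n) (B' n)" for n
    using inverse_pair_rank_one_update[of "unit_row n" "\<lambda>k. - ?d n k"]
    by (simp add: B_def B'_def dn)
  ultimately have step_inverse: "inverse_pair (rf_mult (B n) (A n)) (rf_mult (A' n) (B' n))" for n
    using inverse_pair_mult by blast

  have A_row: "rf_mult (A n) M k = (if k = n then row_mult (x n) M else M k)" for n M k
    by (simp add: A_def rf_mult_rank_one_update v_def row_mult_diff)
  have BA_row: "rf_mult (rf_mult (B n) (A n)) M k =
      (if k = n then row_mult (x n) M else M k - scale_row (?d n k) (row_mult (x n) M))" for n M k
    by (simp add: rf_mult_assoc B_def rf_mult_rank_one_update A_row scale_row_algebra dn)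

  define T where "T = rec_nat rf_one (\<lambda>n X. rf_mult (rf_mult (B n) (A n)) X)"
  define S where "S = rec_nat rf_one (\<lambda>n X. rf_mult X (rf_mult (A' n) (B' n)))"
  have T0: "T 0 = rf_one" and TSuc: "T (Suc n) = rf_mult (rf_mult (B n) (A n)) (T n)" for n
    by (simp_all add: T_def)
  have S0: "S 0 = rf_one" and SSuc: "S (Suc n) = rf_mult (S n) (rf_mult (A' n) (B' n))" for n
    by (simp_all add: S_def)
  have TS: "inverse_pair (T n) (S n)" for n
    by (induction n) (auto simp: T0 S0 TSuc SSuc inverse_pair_mult step_inverse,
        simp add: inverse_pair_def)
  have TC: "gauss_jordan C n = rf_mult (T n) C" for n
  proof (induction n)
    case (Suc n)
    have "gauss_jordan C (Suc n) k = rf_mult (rf_mult (B n) (A n)) (gauss_jordan C n) k" for k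
      unfolding BA_row gauss_jordan_Suc_row x(3) by simp
    then show ?case by (simp add: TSuc rf_mult_assoc Suc fun_eq_iff)
  qed (simp add: T0)

  have "finite {n. T (Suc n) k \<noteq> T n k}" for k
    by (rule finite_subset[of _ "insert k {n. ?d n k \<noteq> 0}"])
       (auto simp: finite_jordan_coeff TSuc BA_row)
  then obtain T' where T': "rows_converge T T'" using rows_convergeI by blast

  \<comment> \<open>For a row \<open>k\<close> of \<open>S n\<close> that vanishes at \<open>n\<close>, only the inverse of the Jordan elimination has an
    effect, and it can create an entry at \<open>n\<close> only. This applies to every row \<open>k\<close> other than \<open>n\<close>:
    for \<open>k > n\<close> it is a unit row, and for \<open>k < n\<close> its support is below \<open>n\<close>.\<close>
  have S_step: "S (Suc n) k = S n k + scale_row (pairing (S n k) (?d n)) (unit_row n)"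
    if "entry (S n k) n = 0" for n k
    using that
    by (simp add: SSuc rf_mult_row A'_row B'_row flip: row_mult_assoc)
  have S_late: "S n k = unit_row k" if "n \<le> k" for n k
    using that
  proof (induction n)
    case (Suc n)
    then show ?case using S_step[of n k] by (simp add: lookup_single jordan_coeff_def)
  qed (simp add: S0 rf_one_def)
  have S_support: "support (S n k) \<subseteq> {..<n}" if "Suc k \<le> n" for n k
    using that
  proof (induction n rule: nat_induct_at_least)
    case base
    have "S (Suc k) k = row_mult (row_mult (unit_row k) (A' k)) (B' k)"
      by (simp add: SSuc rf_mult_row S_late row_mult_assoc)
    also have "support \<dots> \<subseteq> {..k}"
      using x(2)[of k]
      by (auto simp: A'_row B'_row v_def lookup_add lookup_minus
          lookup_single when_def in_keys_iff subset_iff split: if_splits)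
    finally show ?case by auto
  next
    case (Suc n)
    then have "entry (S n k) n = 0" by (auto simp: in_keys_iff subset_iff)
    from S_step[OF this] Suc show ?case
      by (auto simp: in_keys_iff lookup_add lookup_single when_def subset_iff split: if_splits)
  qed
  have "finite {n. S (Suc n) k \<noteq> S n k}" for k
  proof -
    \<comment> \<open>The largest pivot over the support of row \<open>k\<close> when that row first appears. An index \<open>n\<close>
      that joins the support later has a pivot below one that is already present, so the bound persists.
      The added \<open>0\<close> covers an empty support.\<close>
    define b where "b = Max (insert 0 ((\<lambda>i. pivot (?G i)) ` support (S (Suc k) k)))"
    have step: "S (Suc n) k = S n k + scale_row (pairing (S n k) (?d n)) (unit_row n)"
      if "Suc k \<le> n" for n
      using S_support[OF that] by (intro S_step) (auto simp: in_keys_iff subset_iff)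
    have small: "?G n \<noteq> 0 \<and> pivot (?G n) < b"
      if "pairing (S n k) (?d n) \<noteq> 0" "\<forall>i\<in>support (S n k). pivot (?G i) \<le> b" for n
    proof -
      have "\<exists>i\<in>support (S n k). ?d n i \<noteq> 0"
        by (rule ccontr) (use that(1) in \<open>simp add: pairing_def\<close>)
      then obtain i where "i \<in> support (S n k)" "?d n i \<noteq> 0" by blast
      then show ?thesis using jordan_coeff_nonzero[of C n i] that(2) by force
    qed
    have bound: "\<forall>i\<in>support (S n k). pivot (?G i) \<le> b" if "Suc k \<le> n" for n
      using that
    proof (induction n rule: nat_induct_at_least)
      case base
      then show ?case by (auto simp: b_def intro: Max_ge)
    next
      case (Suc n)
      show ?case
      proof
        fix i assume "i \<in> support (S (Suc n) k)"
        then have "i \<in> support (S n k) \<or> i = n \<and> pairing (S n k) (?d n) \<noteq> 0"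
          unfolding step[OF Suc.hyps]
          by (auto simp: in_keys_iff lookup_add lookup_single when_def split: if_splits)
        then show "pivot (?G i) \<le> b" using Suc.IH small by force
      qed
    qed
    have "S (Suc n) k \<noteq> S n k \<Longrightarrow> n \<le> k \<or> ?G n \<noteq> 0 \<and> pivot (?G n) < b" for n
      using step[of n] small[OF _ bound, of n]
      by (cases "n \<le> k"; cases "pairing (S n k) (?d n) = 0") auto
    then show ?thesis
      by (intro finite_subset[OF _ finite_UnI[OF finite_atMost finite_small_pivots], of _ k C b]) auto
  qed
  then obtain S' where S': "rows_converge S S'" using rows_convergeI by blast
  have "inverse_pair T' S'" using T' S' TS by (rule inverse_pair_limit)
  moreover have "rows_converge (gauss_jordan C) (rf_mult T' C)"
    using rows_converge_rf_mult[OF T' rows_converge_const[of C]] by (simp flip: TC)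
  then have "gauss_jordan_result C = rf_mult T' C"
    using rows_converge_unique gauss_jordan_converges by blast
  ultimately show ?thesis by blast
qed

text \<open>
  The limit of the invariant \<open>reduced_below\<close> over all rows.
\<close>

definition reduced :: "'a::field rf_matrix \<Rightarrow> bool" where
  "reduced L \<longleftrightarrow>
     (\<forall>i. L i \<noteq> 0 \<longrightarrow> entry (L i) (pivot (L i)) = 1 \<and> (\<forall>j. j \<noteq> i \<longrightarrow> entry (L j) (pivot (L i)) = 0))"

lemma reduced_gauss_jordan_result: "reduced (gauss_jordan_result C)"
proof -
  let ?L = "gauss_jordan_result C"
  have "entry (?L i) (pivot (?L i)) = 1 \<and> (j \<noteq> i \<longrightarrow> entry (?L j) (pivot (?L i)) = 0)"
    if "?L i \<noteq> 0" for i j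
  proof -
    have "\<forall>\<^sub>F n in sequentially. gauss_jordan C n i = ?L i"
      "\<forall>\<^sub>F n in sequentially. gauss_jordan C n j = ?L j"
      using gauss_jordan_converges[of C] by (auto simp: rows_converge_def)
    moreover have "\<forall>\<^sub>F n in sequentially. max i j < n"
      by (rule eventually_gt_at_top)
    ultimately have "\<forall>\<^sub>F n in sequentially. entry (?L i) (pivot (?L i)) = 1
        \<and> (j \<noteq> i \<longrightarrow> entry (?L j) (pivot (?L i)) = 0)"
    proof eventually_elim
      case (elim n)
      then show ?case
        using reduced_below_gauss_jordan[of n C, unfolded reduced_below_def, THEN spec[of _ i]] that
        by auto
    qed
    then show ?thesis by simp
  qed
  then show ?thesis by (auto simp: reduced_def)
qed


section \<open>Sorting permutations and the reordering routine\<close>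

lemma ex_bij_betw_strict_mono_nat_sets:
  fixes X Y :: "nat set"
  assumes "finite X \<longleftrightarrow> finite Y" "card X = card Y"
  shows "\<exists>h. bij_betw h X Y \<and> strict_mono_on X h"
proof -
  have "\<exists>I f g. bij_betw f I X \<and> strict_mono_on I f \<and> bij_betw g I Y \<and> strict_mono_on I (g :: nat \<Rightarrow> nat)"
  proof (cases "finite X")
    case True
    with assms show ?thesis
      using ex_bij_betw_strict_mono_card[of X] ex_bij_betw_strict_mono_card[of Y] by metis
  next
    case False
    with assms show ?thesis
      using bij_enumerate strict_mono_enumerate by metis
  qed
  then obtain I :: "nat set" and f g where
    f: "bij_betw f I X" "strict_mono_on I f" and g: "bij_betw g I Y" "strict_mono_on I g"
    by blast
  let ?h = "g \<circ> inv_into I f"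
  have inv: "bij_betw (inv_into I f) X I" using f(1) by (rule bij_betw_inv_into)
  have "strict_mono_on X ?h"
  proof (rule strict_mono_onI)
    fix x y assume xy: "x \<in> X" "y \<in> X" "x < y"
    then have "inv_into I f x \<in> I" "inv_into I f y \<in> I"
      "f (inv_into I f x) = x" "f (inv_into I f y) = y"
      using inv bij_betwE[OF inv] f(1) by (auto simp: bij_betw_inv_into_right)
    then show "?h x < ?h y"
      using xy strict_mono_on_less[OF f(2)] strict_mono_onD[OF g(2)] by (metis comp_apply)
  qed
  then show ?thesis using bij_betw_trans[OF inv g(1)] by blast
qed

text \<open>
  \<open>J\<close> and \<open>r ` J\<close> are order isomorphic as equipotent sets of natural numbers. Following the
  isomorphism by the inverse of \<open>r\<close> gives the permutation of \<open>J\<close> along which \<open>r\<close> increases. For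
  infinite \<open>J\<close> this uses that both order types are \<open>\<omega>\<close>.
\<close>

lemma ex_sorting_permutation:
  fixes J :: "nat set" and r :: "nat \<Rightarrow> nat"
  assumes "inj_on r J"
  shows "\<exists>\<pi>. bij \<pi> \<and> bij_betw \<pi> J J \<and> (\<forall>k. k \<notin> J \<longrightarrow> \<pi> k = k) \<and> strict_mono_on J (r \<circ> \<pi>)"
proof -
  have r: "bij_betw r J (r ` J)" using assms by (rule inj_on_imp_bij_betw)
  obtain h where h: "bij_betw h J (r ` J)" "strict_mono_on J h"
    using ex_bij_betw_strict_mono_nat_sets[of J "r ` J"] bij_betw_finite[OF r] bij_betw_same_card[OF r]
    by blast
  define \<pi> where "\<pi> k = (if k \<in> J then inv_into J r (h k) else k)" for k
  have J: "bij_betw \<pi> J J"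
    using bij_betw_trans[OF h(1) bij_betw_inv_into[OF r]]
    by (rule bij_betw_cong[THEN iffD1, rotated]) (simp add: \<pi>_def)
  moreover have "bij_betw \<pi> (- J) (- J)"
    using bij_betw_id[of "- J"] by (rule bij_betw_cong[THEN iffD1, rotated]) (simp add: \<pi>_def)
  ultimately have "bij \<pi>"
    using bij_betw_combine[of \<pi> J J "- J" "- J"] by simp
  moreover have "r (\<pi> k) = h k" if "k \<in> J" for k
    using that f_inv_into_f[of "h k" r J] bij_betwE[OF h(1)] by (simp add: \<pi>_def)
  then have "strict_mono_on J (r \<circ> \<pi>)"
    using h(2) by (simp add: monotone_on_def)
  ultimately show ?thesis using J by (intro exI[of _ \<pi>]) (simp add: \<pi>_def)
qed

lemma insort_key_map: "insort_key f (g x) (map g xs) = map g (insort_key (f \<circ> g) x xs)"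
  by (induction xs) auto

lemma sort_key_map: "sort_key f (map g xs) = map g (sort_key (f \<circ> g) xs)"
  by (induction xs) (simp_all add: insort_key_map del: comp_apply)

lemma map_upds_map_append:
  assumes "distinct (xs @ xs')" "length ys' = length xs'" "x \<in> set xs"
  shows "(m(xs @ xs' [\<mapsto>] map f xs @ ys')) x = Some (f x)"
  using assms by (induction xs arbitrary: m) auto

text \<open>
  Sorting a finite part of \<open>J\<close> by \<open>r\<close> starts with \<open>\<pi>\<close>'s first values as soon as that part
  contains them: an index of \<open>J\<close> not among these values is \<open>\<pi> j\<close> for some \<open>j > k\<close>, hence has a
  larger key.
\<close>

lemma sort_key_prefix:
  fixes r :: "nat \<Rightarrow> 'b::linorder"
  assumes inj: "inj_on r J" and bij: "bij_betw \<pi> J J" and mono: "strict_mono_on J (r \<circ> \<pi>)"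
    and bound: "\<And>j. j \<in> J \<Longrightarrow> j \<le> k \<Longrightarrow> \<pi> j \<le> n"
  shows "\<exists>zs. sort_key r (sorted_list_of_set (J \<inter> {..n}))
    = map \<pi> (sorted_list_of_set (J \<inter> {..k})) @ zs"
proof -
  define P where "P = J \<inter> {..k}"
  define R where "R = J \<inter> {..n} - \<pi> ` P"
  let ?zs = "sort_key r (sorted_list_of_set R)"
  let ?new = "map \<pi> (sorted_list_of_set P) @ ?zs"
  have fin: "finite P" "finite R" by (auto simp: P_def R_def)
  have P: "\<pi> j \<in> J" "\<pi> j \<le> n" if "j \<in> P" for j
    using that bound bij_betwE[OF bij] by (auto simp: P_def)
  have "inj_on \<pi> P" using bij by (auto simp: bij_betw_def P_def inj_on_def)
  then have dist: "distinct ?new" and set: "set ?new = J \<inter> {..n}"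
    using fin P by (auto simp: distinct_map R_def)
  have less: "r (\<pi> i) \<le> r (\<pi> j)" if "i \<in> J" "j \<in> J" "i \<le> j" for i j
    using that strict_mono_on_leD[OF mono] by simp
  have "sorted (map r (map \<pi> (sorted_list_of_set P)))"
    unfolding map_map sorted_map
    by (rule sorted_wrt_mono_rel[of _ "(\<le>)"]) (use fin less in \<open>auto simp: P_def\<close>)
  moreover have "r (\<pi> i) \<le> r j" if i: "i \<in> P" and j: "j \<in> R" for i j
  proof -
    obtain j' where "j' \<in> J" "j = \<pi> j'"
      using bij j by (auto simp: R_def bij_betw_def)
    moreover from this j have "k < j'" by (auto simp: R_def P_def)
    ultimately show ?thesis using i less by (auto simp: P_def)
  qed
  ultimately have sorted: "sorted (map r ?new)"
    using fin by (auto simp: sorted_append)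
  have inj_n: "inj_on r (J \<inter> {..n})" using inj by (rule inj_on_subset) auto
  have "sort_key r (sorted_list_of_set (J \<inter> {..n})) = ?new"
  proof (rule map_sorted_distinct_set_unique)
    show "distinct (map r ?new)"
      unfolding distinct_map using dist set inj_n by simp
    show "sorted (map r ?new)" by (rule sorted)
    show "inj_on r (set (sort_key r (sorted_list_of_set (J \<inter> {..n}))) \<union> set ?new)"
      unfolding set using inj_n by simp
    show "set (sort_key r (sorted_list_of_set (J \<inter> {..n}))) = set ?new"
      unfolding set by simp
  qed (use inj_n in \<open>simp_all add: distinct_map\<close>)
  then show ?thesis unfolding P_def by blast
qed

lemma top_submatrix_apply: "top_submatrix A n k = (if k \<le> n then A k else None)"
  by (simp add: top_submatrix_def restrict_map_def)

text \<open>
  The routine sorts rows, but since the lengths of the nonzero rows are distinct it can be read as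
  sorting row indices, to which \<open>sort_key_prefix\<close> applies.
\<close>

lemma reorder_top_submatrix:
  fixes L :: "'a::field rf_matrix"
  defines "J \<equiv> {k. L k \<noteq> 0}"
  assumes inj: "inj_on (\<lambda>k. pivot (L k)) J"
    and \<pi>: "bij_betw \<pi> J J" "\<And>k. k \<notin> J \<Longrightarrow> \<pi> k = k" "strict_mono_on J (\<lambda>k. pivot (L (\<pi> k)))"
    and bound: "\<And>j. j \<le> k \<Longrightarrow> \<pi> j \<le> n" and "k \<le> n" "j \<le> k"
  shows "reorder (top_submatrix (Some \<circ> L) n) j = Some (L (\<pi> j))"
proof -
  let ?A = "top_submatrix (Some \<circ> L) n"
  have A: "?A i = (if i \<le> n then Some (L i) else None)" for i
    by (simp add: top_submatrix_apply)
  define ps where "ps = sorted_list_of_set (J \<inter> {..n})"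
  have "{k \<in> dom ?A. ?A k \<noteq> Some 0} = J \<inter> {..n}"
    unfolding dom_def A J_def by auto
  moreover have "map (\<lambda>k. the (?A k)) ps = map L ps"
    unfolding A by (auto simp: ps_def)
  ultimately have "reorder ?A = ?A(ps [\<mapsto>] sort_key row_length (map L ps))"
    unfolding reorder_def ps_def by (simp only: Let_def)
  then have reorder: "reorder ?A = ?A(ps [\<mapsto>] map L (sort_key (row_length \<circ> L) ps))"
    by (simp only: sort_key_map)
  show ?thesis
  proof (cases "j \<in> J")
    case False
    then have "\<pi> j = j" "j \<notin> set ps" using \<pi>(2) by (auto simp: ps_def)
    then show ?thesis
      unfolding reorder using \<open>k \<le> n\<close> \<open>j \<le> k\<close> by (simp add: A)
  next
    case True
    let ?front = "sorted_list_of_set (J \<inter> {..k})" and ?back = "sorted_list_of_set (J \<inter> {k<..n})"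
    have len: "row_length (L i) = int (pivot (L i))" if "i \<in> J" for i
      using that by (simp add: J_def row_length_nonzero)
    have "\<exists>zs. sort_key (row_length \<circ> L) ps = map \<pi> ?front @ zs"
      unfolding ps_def
    proof (rule sort_key_prefix[OF _ \<pi>(1)])
      show "inj_on (row_length \<circ> L) J"
        using inj by (simp add: inj_on_def len)
      show "strict_mono_on J ((row_length \<circ> L) \<circ> \<pi>)"
        using \<pi>(3) bij_betwE[OF \<pi>(1)] by (simp add: monotone_on_def len)
    qed (use bound in auto)
    then obtain zs where zs: "sort_key (row_length \<circ> L) ps = map \<pi> ?front @ zs" by blast
    have ps: "ps = ?front @ ?back"
      unfolding ps_def using \<open>k \<le> n\<close>
      by (intro sorted_distinct_set_unique) (auto simp: sorted_append)
    have "length (map L zs) = length ?back"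
      using arg_cong[OF zs, of length] by (simp add: ps)
    moreover have "distinct (?front @ ?back)" by auto
    ultimately have *: "(?A(?front @ ?back [\<mapsto>] map (L \<circ> \<pi>) ?front @ map L zs)) j = Some ((L \<circ> \<pi>) j)"
      using True \<open>j \<le> k\<close> by (intro map_upds_map_append) auto
    have "reorder ?A = ?A(?front @ ?back [\<mapsto>] map (L \<circ> \<pi>) ?front @ map L zs)"
      unfolding reorder zs map_append map_map ps[symmetric] ..
    with * show ?thesis by (simp only: comp_apply)
  qed
qed

text \<open>
  Row \<open>k\<close> and the rows above it are settled once \<open>n\<close> has passed \<open>k\<close> and all of
  \<open>\<pi> 0, \<dots>, \<pi> k\<close>.
\<close>

lemma reorder_stabilizes:
  fixes L :: "'a::field rf_matrix"
  defines "J \<equiv> {k. L k \<noteq> 0}"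
  assumes inj: "inj_on (\<lambda>k. pivot (L k)) J"
    and \<pi>: "bij_betw \<pi> J J" "\<And>k. k \<notin> J \<Longrightarrow> \<pi> k = k" "strict_mono_on J (\<lambda>k. pivot (L (\<pi> k)))"
  shows "\<forall>\<^sub>F n in sequentially.
    top_submatrix (reorder (top_submatrix (Some \<circ> L) n)) k = top_submatrix (Some \<circ> (L \<circ> \<pi>)) k"
proof -
  have "\<forall>\<^sub>F n in sequentially. max k (Max (\<pi> ` {..k})) \<le> n"
    by (rule eventually_ge_at_top)
  then show ?thesis
  proof eventually_elim
    case (elim n)
    then have "k \<le> n" and "\<pi> j \<le> n" if "j \<le> k" for j using that by auto
    then show ?case
      using reorder_top_submatrix[OF inj[unfolded J_def] \<pi>[unfolded J_def], of k n] elim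
      by (auto simp: fun_eq_iff top_submatrix_apply)
  qed
qed

lemma reorder_result_eq:
  assumes "\<And>k. \<forall>\<^sub>F n in sequentially.
    top_submatrix (reorder (top_submatrix (Some \<circ> L) n)) k = top_submatrix (Some \<circ> H) k"
  shows "reorder_result L = H"
  unfolding reorder_result_def
proof (rule the_equality)
  fix H'
  assume H': "\<forall>k. \<forall>\<^sub>F n in sequentially.
    top_submatrix (reorder (top_submatrix (Some \<circ> L) n)) k = top_submatrix (Some \<circ> H') k"
  show "H' = H"
  proof
    fix k
    have "\<forall>\<^sub>F n in sequentially. top_submatrix (Some \<circ> H') k = top_submatrix (Some \<circ> H) k"
      using assms[of k] H'[rule_format, of k] by eventually_elim simp
    then have "top_submatrix (Some \<circ> H') k k = top_submatrix (Some \<circ> H) k k" by simp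
    then show "H' k = H k" by (simp add: top_submatrix_apply)
  qed
qed (use assms in blast)

lemma reduced_pivots_distinct:
  assumes "reduced L"
  shows "inj_on (\<lambda>k. pivot (L k)) {k. L k \<noteq> 0}"
  using assms unfolding inj_on_def reduced_def by (metis (mono_tags) mem_Collect_eq zero_neq_one)

lemma reorder_result_permutes:
  assumes "reduced L"
  obtains \<pi> where "bij \<pi>" "reorder_result L = L \<circ> \<pi>"
    "strict_mono_on {k. L (\<pi> k) \<noteq> 0} (\<lambda>k. pivot (L (\<pi> k)))"
    "\<And>k. \<forall>\<^sub>F n in sequentially.
      top_submatrix (reorder (top_submatrix (Some \<circ> L) n)) k
        = top_submatrix (Some \<circ> reorder_result L) k"
proof -
  let ?J = "{k. L k \<noteq> 0}"
  note inj = reduced_pivots_distinct[OF assms]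
  obtain \<pi> where \<pi>: "bij \<pi>" "bij_betw \<pi> ?J ?J" "\<And>k. k \<notin> ?J \<Longrightarrow> \<pi> k = k"
    "strict_mono_on ?J (\<lambda>k. pivot (L (\<pi> k)))"
    using ex_sorting_permutation[OF inj] unfolding comp_def by blast
  note stable = reorder_stabilizes[OF inj \<pi>(2-4)]
  have "L (\<pi> k) \<noteq> 0 \<longleftrightarrow> L k \<noteq> 0" for k
    using bij_betwE[OF \<pi>(2)] \<pi>(3)[of k] by (cases "k \<in> ?J") auto
  then have "strict_mono_on {k. L (\<pi> k) \<noteq> 0} (\<lambda>k. pivot (L (\<pi> k)))"
    using \<pi>(4) by simp
  with \<pi>(1) reorder_result_eq[OF stable] stable show ?thesis
    by (intro that) simp_all
qed

section \<open>The quasi-Hermite form and its chain of top submatrices\<close>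

text \<open>
  In a reduced matrix a pivot column is cleared above and below its pivot, so the order of the rows
  matters only for the monotonicity of the lengths.
\<close>

lemma quasi_hermite_permuted:
  assumes "reduced L" "inj \<pi>" "strict_mono_on {k. L (\<pi> k) \<noteq> 0} (\<lambda>k. pivot (L (\<pi> k)))"
  shows "quasi_hermite (L \<circ> \<pi>)"
  using assms
  by (auto simp: quasi_hermite_def reduced_def monotone_on_def row_length_nonzero inj_eq)

lemma strict_submatrix_top:
  assumes "n < k" "k \<in> dom B"
  shows "strict_submatrix (top_submatrix B n) B"
proof -
  obtain y where "B k = Some y" using assms(2) by auto
  then have "(k, y) \<in> Map.graph B - Map.graph (top_submatrix B n)"
    using assms(1) by (auto simp: graph_def top_submatrix_apply)
  moreover have "Map.graph (top_submatrix B n) \<subseteq> Map.graph B"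
    by (auto simp: graph_def top_submatrix_apply split: if_splits)
  ultimately show ?thesis unfolding strict_submatrix_def by blast
qed

lemma top_submatrix_top: "m \<le> n \<Longrightarrow> top_submatrix (top_submatrix A n) m = top_submatrix A m"
  by (auto simp: top_submatrix_apply fun_eq_iff)

lemma dom_reorder: "dom (reorder A) = dom A"
  by (cases "finite {k \<in> dom A. A k \<noteq> Some 0}") (auto simp: reorder_def Let_def)

text \<open>
  Since \<open>H\<close> has one row per index, a part of it is determined by its set of indices. This makes the
  chain independent of the choice of the \<open>\<delta>\<^sub>n\<close>.
\<close>

lemma submatrix_of_full_rows_eq_top:
  assumes "strict_submatrix (top_submatrix A n) (Some \<circ> H)" "{..n} \<subseteq> dom A"
  shows "top_submatrix A n = top_submatrix (Some \<circ> H) n"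
proof
  fix k
  show "top_submatrix A n k = top_submatrix (Some \<circ> H) n k"
  proof (cases "k \<le> n")
    case True
    then obtain y where "A k = Some y" using assms(2) by auto
    with True have "(k, y) \<in> Map.graph (top_submatrix A n)"
      by (simp add: graph_def top_submatrix_apply)
    with assms(1) have "(k, y) \<in> Map.graph (Some \<circ> H)"
      by (auto simp: strict_submatrix_def)
    with True \<open>A k = Some y\<close> show ?thesis by (simp add: graph_def top_submatrix_apply)
  qed (simp add: top_submatrix_apply)
qed

text \<open>
  The transformation taking \<open>C\<close> to \<open>H\<close> is the permutation matrix of \<open>\<pi>\<close> times the one taking \<open>C\<close>
  to \<open>L\<close>.
\<close>

theorem corollary42:
  fixes C L H :: "'a::field rf_matrix"
    and Q :: "nat \<Rightarrow> 'a row_seq"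
  assumes "L = gauss_jordan_result C"
    and "\<And>n. Q n = reorder (top_submatrix (Some \<circ> L) n)"
    and "H = reorder_result L"
  shows "quasi_hermite_form_of H C \<and>
    (\<forall>n. \<exists>d\<ge>n. strict_submatrix (top_submatrix (Q d) n) (Some \<circ> H)) \<and>
    (\<forall>\<delta>. (\<forall>n. \<delta> n \<ge> n \<and> strict_submatrix (top_submatrix (Q (\<delta> n)) n) (Some \<circ> H)) \<longrightarrow>
      (\<forall>n. strict_submatrix (top_submatrix (Q (\<delta> n)) n)
                              (top_submatrix (Q (\<delta> (Suc n))) (Suc n))))"
proof (intro conjI allI impI)
  have L: "reduced L" using assms(1) reduced_gauss_jordan_result by simp
  obtain \<pi> where \<pi>: "bij \<pi>" and H: "H = L \<circ> \<pi>"
    and mono: "strict_mono_on {k. L (\<pi> k) \<noteq> 0} (\<lambda>k. pivot (L (\<pi> k)))"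
    and stable: "\<And>k. \<forall>\<^sub>F n in sequentially. top_submatrix (Q n) k = top_submatrix (Some \<circ> H) k"
    using reorder_result_permutes[OF L] unfolding assms(2,3) by metis

  obtain T S where T: "inverse_pair T S" "L = rf_mult T C"
    using gauss_jordan_result_transform assms(1) by blast
  let ?P = "\<lambda>k. unit_row (\<pi> k) :: 'a row"
  have "H = rf_mult ?P L"
    by (simp add: H fun_eq_iff rf_mult_row)
  then have "H = rf_mult (rf_mult ?P T) C"
    by (simp add: T(2) rf_mult_assoc)
  moreover have "rf_invertible (rf_mult ?P T)"
    using inverse_pair_mult[OF inverse_pair_permutation[OF \<pi>] T(1)]
    unfolding rf_invertible_def inverse_pair_def by blast
  moreover have "quasi_hermite H"
    unfolding H using L bij_is_inj[OF \<pi>] mono by (rule quasi_hermite_permuted)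
  ultimately show "quasi_hermite_form_of H C"
    unfolding quasi_hermite_form_of_def by blast

  show "\<exists>d\<ge>n. strict_submatrix (top_submatrix (Q d) n) (Some \<circ> H)" for n
  proof -
    have "\<forall>\<^sub>F d in sequentially. n \<le> d \<and> top_submatrix (Q d) n = top_submatrix (Some \<circ> H) n"
      using stable[of n] eventually_ge_at_top[of n] by eventually_elim simp
    then obtain d where "n \<le> d" "top_submatrix (Q d) n = top_submatrix (Some \<circ> H) n"
      unfolding eventually_sequentially by blast
    with strict_submatrix_top[of n "Suc n" "Some \<circ> H"] show ?thesis by (auto simp: domIff)
  qed

  fix \<delta> n
  assume \<delta>: "\<forall>n. n \<le> \<delta> n \<and> strict_submatrix (top_submatrix (Q (\<delta> n)) n) (Some \<circ> H)"
  have "top_submatrix (Q (\<delta> m)) m = top_submatrix (Some \<circ> H) m" for m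
  proof (rule submatrix_of_full_rows_eq_top)
    have "dom (Q (\<delta> m)) = {..\<delta> m}"
      by (auto simp: assms(2) dom_reorder top_submatrix_apply split: if_splits)
    then show "{..m} \<subseteq> dom (Q (\<delta> m))" using \<delta> by auto
  qed (use \<delta> in blast)
  then show "strict_submatrix (top_submatrix (Q (\<delta> n)) n) (top_submatrix (Q (\<delta> (Suc n))) (Suc n))"
    using strict_submatrix_top[of n "Suc n" "top_submatrix (Some \<circ> H) (Suc n)"]
    by (simp add: top_submatrix_top top_submatrix_apply domIff)
qed

end
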